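(* Suppose the basic assumptions (1)–(5) hold in the template matching model $Y_i = f(X_i-\theta^* )+Z_i$. Assume, in addition, that $\phi$ has finite first moment and that $t\mapsto B(t):=\int\phi(y)\log\phi(y-t)\,dy$ has a derivative which is Lipschitz near the origin. If $f$ is $\alpha$-Hölder (with $0<\alpha\le1$), then the minimax risk satisfies $n^{1/(2\alpha)}R_n^*\gtrsim1$; if instead $f$ is discontinuous and piecewise $\alpha$-Hölder with $\alpha\ge1/2$, then $nR_n^*\gtrsim1$.
   Context: Model. We observe $(X_1,Y_1),\dots,(X_n,Y_n)$ with $Y_i = f(X_i-\theta^* )+Z_i$, where $f:\mathbb{R}\to\mathbb{R}$ is a known function (the template) and $\theta^*\in\mathbb{R}$ is the unknown shift. The design points $X_i$ are iid with density $\lambda$; the noise variables $Z_i$ are iid with density $\phi$ and independent of the design points. $\mathbb{E}$ is expectation under the true shift $\theta^*$. Under shift $\theta$, $(X,Y)$ has density $p_\theta(x,y)=\lambda(x)\phi(y-f(x-\theta))$, and $\mathbb{E}_\theta$ denotes expectation when the sample is iid from $p_\theta$. Loss. $L:\mathbb{R}\to\mathbb{R}$ is a loss function and $M(\theta):=\mathbb{E}[L(Y-f(X-\theta))]$. Basic assumptions. (1) $f$ is compactly supported and càdlàg with none or finitely many discontinuities (in particular bounded); and for any $\theta\neq\theta^*$, $\int (f(x-\theta^* )-f(x-\theta))^2\lambda(x)\,dx>0$. (2) $\lambda$ is compactly supported. (3) $\phi$ is even. (4) $L$ is non-negative, even, non-decreasing away from the origin (i.e., on $[0,\infty)$), non-constant,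 and either Lipschitz or has a Lipschitz derivative. (5) $M$ is well-defined (finite); $\theta^*$ is the unique minimizer of $M$; and $\inf\{M(\theta):|\theta-\theta^*|\ge\delta\}>M(\theta^* )$ for every $\delta>0$. $f$ is $\alpha$-Hölder if $\sup_{x_1\ne x_2}|f(x_1)-f(x_2)|/|x_1-x_2|^\alpha<\infty$. $f$ is piecewise $\alpha$-Hölder if, for some finite $H$, $|f(x_1)-f(x_2)|\le H|x_1-x_2|^\alpha$ whenever $f$ has no discontinuity between $x_1$ and $x_2$. Minimax risk. $\mathrm{risk}(\hat\theta_n,\theta):=\mathbb{E}_\theta[|\hat\theta_n-\theta|]$ and $R_n^*:=\inf_{\hat\theta_n}\sup_\theta\mathrm{risk}(\hat\theta_n,\theta)$, the infimum being over all estimators based on a sample of size $n$. If $A$ is such that $f$ and $\lambda$ are both supported on $[-A,A]$, the model is $Y_i=Z_i$ for every $\theta$ outside $[-2A,2A]$, so the parameter is effectively restricted to the compact interval $[-2A,2A]$. $\gtrsim$ means inequality up to a positive multiplicative constant not depending on $n$. *)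

theory Defs
  imports "HOL-Probability.Probability"
begin

definition is_density :: "(real \<Rightarrow> real) \<Rightarrow> bool" where
  "is_density g \<longleftrightarrow> g \<in> borel_measurable borel \<and> (\<forall>x. 0 \<le> g x) \<and>
     prob_space (density lborel (\<lambda>x. ennreal (g x)))"

text \<open>The law \<open>p\<^sub>\<theta>(x,y) = lam x * \<phi> (y - f (x - \<theta>))\<close> of one observation
  \<open>(X, f (X - \<theta>) + Z)\<close>, where \<open>X\<close> and \<open>Z\<close> are independent with densities \<open>lam\<close> and \<open>\<phi>\<close>.\<close>

definition obs_law ::
  "(real \<Rightarrow> real) \<Rightarrow> (real \<Rightarrow> real) \<Rightarrow> (real \<Rightarrow> real) \<Rightarrow> real \<Rightarrow> (real \<times> real) measure" where
  "obs_law f lam \<phi> \<theta> = density lborel (\<lambda>(x, y). ennreal (lam x * \<phi> (y - f (x - \<theta>))))"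

definition sample_law ::
  "(real \<Rightarrow> real) \<Rightarrow> (real \<Rightarrow> real) \<Rightarrow> (real \<Rightarrow> real) \<Rightarrow> nat \<Rightarrow> real
     \<Rightarrow> (nat \<Rightarrow> real \<times> real) measure" where
  "sample_law f lam \<phi> n \<theta> = PiM {..<n} (\<lambda>_. obs_law f lam \<phi> \<theta>)"

definition estimators :: "nat \<Rightarrow> ((nat \<Rightarrow> real \<times> real) \<Rightarrow> real) set" where
  "estimators n = borel_measurable (PiM {..<n} (\<lambda>_. borel))"

definition risk ::
  "(real \<Rightarrow> real) \<Rightarrow> (real \<Rightarrow> real) \<Rightarrow> (real \<Rightarrow> real) \<Rightarrow> nat
     \<Rightarrow> ((nat \<Rightarrow> real \<times> real) \<Rightarrow> real) \<Rightarrow> real \<Rightarrow> ennreal" where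
  "risk f lam \<phi> n T \<theta> = (\<integral>\<^sup>+ s. ennreal \<bar>T s - \<theta>\<bar> \<partial>sample_law f lam \<phi> n \<theta>)"

definition minimax_risk ::
  "(real \<Rightarrow> real) \<Rightarrow> (real \<Rightarrow> real) \<Rightarrow> (real \<Rightarrow> real) \<Rightarrow> real set \<Rightarrow> nat \<Rightarrow> ennreal" where
  "minimax_risk f lam \<phi> \<Theta> n = (INF T\<in>estimators n. SUP \<theta>\<in>\<Theta>. risk f lam \<phi> n T \<theta>)"

definition M_fun ::
  "(real \<Rightarrow> real) \<Rightarrow> (real \<Rightarrow> real) \<Rightarrow> (real \<Rightarrow> real) \<Rightarrow> (real \<Rightarrow> real) \<Rightarrow> real \<Rightarrow> real \<Rightarrow> real" where
  "M_fun f lam \<phi> L \<theta>s \<theta> = (\<integral>(x, y). L (y - f (x - \<theta>)) \<partial>obs_law f lam \<phi> \<theta>s)"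

definition cadlag :: "(real \<Rightarrow> real) \<Rightarrow> bool" where
  "cadlag f \<longleftrightarrow> (\<forall>x. continuous (at_right x) f \<and> (\<exists>l. (f \<longlongrightarrow> l) (at_left x)))"

definition compactly_supported :: "(real \<Rightarrow> real) \<Rightarrow> bool" where
  "compactly_supported g \<longleftrightarrow> compact (closure {x. g x \<noteq> 0})"

definition discontinuities :: "(real \<Rightarrow> real) \<Rightarrow> real set" where
  "discontinuities f = {x. \<not> isCont f x}"

definition template_assumption :: "(real \<Rightarrow> real) \<Rightarrow> (real \<Rightarrow> real) \<Rightarrow> real \<Rightarrow> bool" where
  "template_assumption f lam \<theta>s \<longleftrightarrow>
     compactly_supported f \<and> cadlag f \<and> finite (discontinuities f) \<and>
     (\<forall>\<theta>. \<theta> \<noteq> \<theta>s \<longrightarrow> (\<integral>x. (f (x - \<theta>s) - f (x - \<theta>))\<^sup>2 * lam x \<partial>lborel) > 0)"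

definition loss_assumption :: "(real \<Rightarrow> real) \<Rightarrow> bool" where
  "loss_assumption L \<longleftrightarrow>
     (\<forall>x. 0 \<le> L x) \<and> (\<forall>x. L (- x) = L x) \<and> mono_on {0..} L \<and> (\<exists>x y. L x \<noteq> L y) \<and>
     ((\<exists>K. K-lipschitz_on UNIV L) \<or>
      ((\<forall>x. L differentiable (at x)) \<and> (\<exists>K. K-lipschitz_on UNIV (deriv L))))"

definition contrast_assumption ::
  "(real \<Rightarrow> real) \<Rightarrow> (real \<Rightarrow> real) \<Rightarrow> (real \<Rightarrow> real) \<Rightarrow> (real \<Rightarrow> real) \<Rightarrow> real \<Rightarrow> bool" where
  "contrast_assumption f lam \<phi> L \<theta>s \<longleftrightarrow>
     (\<forall>\<theta>. integrable (obs_law f lam \<phi> \<theta>s) (\<lambda>(x, y). L (y - f (x - \<theta>)))) \<and>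
     (\<forall>\<theta>. \<theta> \<noteq> \<theta>s \<longrightarrow> M_fun f lam \<phi> L \<theta>s \<theta>s < M_fun f lam \<phi> L \<theta>s \<theta>) \<and>
     (\<forall>\<delta>>0. (INF \<theta>\<in>{\<theta>. \<bar>\<theta> - \<theta>s\<bar> \<ge> \<delta>}. M_fun f lam \<phi> L \<theta>s \<theta>) > M_fun f lam \<phi> L \<theta>s \<theta>s)"

definition basic_assumptions ::
  "(real \<Rightarrow> real) \<Rightarrow> (real \<Rightarrow> real) \<Rightarrow> (real \<Rightarrow> real) \<Rightarrow> (real \<Rightarrow> real) \<Rightarrow> real \<Rightarrow> bool" where
  "basic_assumptions f lam \<phi> L \<theta>s \<longleftrightarrow>
     template_assumption f lam \<theta>s \<and>
     compactly_supported lam \<and>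
     (\<forall>z. \<phi> (- z) = \<phi> z) \<and>
     loss_assumption L \<and>
     contrast_assumption f lam \<phi> L \<theta>s"

definition holder :: "real \<Rightarrow> (real \<Rightarrow> real) \<Rightarrow> bool" where
  "holder \<alpha> f \<longleftrightarrow> bdd_above {\<bar>f x1 - f x2\<bar> / \<bar>x1 - x2\<bar> powr \<alpha> | x1 x2. x1 \<noteq> x2}"

text \<open>\<open>Between\<close> includes the end points: a cadlag \<open>f\<close> that jumps at \<open>x2\<close> cannot
  satisfy the bound for all \<open>x1 < x2\<close> close to \<open>x2\<close>.\<close>

definition piecewise_holder :: "real \<Rightarrow> (real \<Rightarrow> real) \<Rightarrow> bool" where
  "piecewise_holder \<alpha> f \<longleftrightarrow>
     (\<exists>H. \<forall>x1 x2. x1 \<le> x2 \<longrightarrow> {x1..x2} \<inter> discontinuities f = {} \<longrightarrow>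
        \<bar>f x1 - f x2\<bar> \<le> H * \<bar>x1 - x2\<bar> powr \<alpha>)"

definition B_fun :: "(real \<Rightarrow> real) \<Rightarrow> real \<Rightarrow> real" where
  "B_fun \<phi> t = (\<integral>y. \<phi> y * ln (\<phi> (y - t)) \<partial>lborel)"

text \<open>In HOL \<open>ln 0\<close> is a real number, whereas mathematically \<open>B t = -\<infinity>\<close> when \<open>\<phi> (y - t)\<close>
  vanishes on a set of positive mass for \<open>\<phi>\<close>. The first conjunct excludes this case. Where
  \<open>\<phi> y = 0\<close> the integrand is zero.\<close>

definition B_finite :: "(real \<Rightarrow> real) \<Rightarrow> real \<Rightarrow> bool" where
  "B_finite \<phi> t \<longleftrightarrow>
     (AE y in lborel. \<phi> y > 0 \<longrightarrow> \<phi> (y - t) > 0) \<and>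
     integrable lborel (\<lambda>y. \<phi> y * ln (\<phi> (y - t)))"

definition B_smooth_near_0 :: "(real \<Rightarrow> real) \<Rightarrow> bool" where
  "B_smooth_near_0 \<phi> \<longleftrightarrow>
     (\<exists>\<epsilon>>0. (\<forall>t\<in>{-\<epsilon><..<\<epsilon>}. B_finite \<phi> t \<and> B_fun \<phi> differentiable (at t)) \<and>
        (\<exists>K. K-lipschitz_on {-\<epsilon><..<\<epsilon>} (deriv (B_fun \<phi>))))"

end

theory Submission
  imports Defs
begin

text \<open>
  The proof compares two shifts \<open>a\<close> and \<open>b\<close> whose samples of size \<open>n\<close> cannot be told apart
  reliably; every estimator then errs by a multiple of \<open>\<bar>a - b\<bar>\<close> at one of them
  (\<open>two_point_lower_bound\<close>). Indistinguishability is measured by the Hellinger affinity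
  \<open>\<integral> sqrt (p q)\<close>, which multiplies over independent observations: if the affinity for one
  observation is at least \<open>1 - 1 / (2 n)\<close>, then the one for \<open>n\<close> observations is at least \<open>1 / 2\<close>
  by Bernoulli's inequality.

  For one observation, conditioning on the design point \<open>x\<close> leaves the affinity between \<open>\<phi>\<close> and
  its translate by \<open>t = f (x - b) - f (x - a)\<close>. Its deficit from \<open>1\<close> is at most half the
  Kullback--Leibler divergence \<open>B 0 - B t\<close>. As \<open>B\<close> is maximal at \<open>0\<close> and has a Lipschitz derivative
  there, the deficit is \<open>O(t\<^sup>2)\<close> for small \<open>t\<close>; being at most \<open>1\<close>, it is \<open>O(t\<^sup>2)\<close> for all
  \<open>t\<close> (\<open>hellinger_deficit_quadratic\<close>). This boundedness is the reason for preferring the affinity to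
  the divergence: across a jump of \<open>f\<close> the divergence may be infinite.

  If \<open>f\<close> is \<open>\<alpha>\<close>-Hoelder, the deficit at distance \<open>\<Delta>\<close> is \<open>O(\<Delta> powr (2 \<alpha>))\<close> uniformly in \<open>x\<close>, so
  \<open>\<Delta>\<close> may be a multiple of \<open>n powr (- 1 / (2 \<alpha>))\<close>. If \<open>f\<close> is piecewise \<open>\<alpha>\<close>-Hoelder with
  \<open>\<alpha> \<ge> 1 / 2\<close>, the deficit is \<open>O(\<Delta>)\<close> except when \<open>x\<close> lies within \<open>\<Delta>\<close> to the right of a shifted
  discontinuity. The design density may be unbounded, so the probability of this event can
  exceed every multiple of \<open>\<Delta>\<close> at a particular shift; but its average over the shifts in
  \<open>[0, A]\<close> is \<open>O(\<Delta>)\<close>, and the base point is chosen, depending on \<open>n\<close>, where it is no larger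
  than that (\<open>exists_light_shift\<close>). Hence \<open>\<Delta>\<close> may be a multiple of \<open>1 / n\<close>.
\<close>

section \<open>Hellinger affinity of a density and its translates\<close>

definition hellinger_affinity :: "(real \<Rightarrow> real) \<Rightarrow> real \<Rightarrow> ennreal" where
  "hellinger_affinity \<phi> t = (\<integral>\<^sup>+ y. ennreal (sqrt (\<phi> y * \<phi> (y - t))) \<partial>lborel)"

lemma is_densityD:
  assumes "is_density g"
  shows "g \<in> borel_measurable borel" and "0 \<le> g x"
    and "(\<integral>\<^sup>+ x. ennreal (g x) \<partial>lborel) = 1"
    and "integrable lborel g" and "(\<integral>x. g x \<partial>lborel) = 1"
proof -
  show m[measurable]: "g \<in> borel_measurable borel" and nn: "0 \<le> g x" for x
    using assms by (auto simp: is_density_def)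
  have "emeasure (density lborel (\<lambda>x. ennreal (g x))) (space lborel) = 1"
    using assms prob_space.emeasure_space_1[of "density lborel (\<lambda>x. ennreal (g x))"]
    by (simp add: is_density_def)
  then show I: "(\<integral>\<^sup>+ x. ennreal (g x) \<partial>lborel) = 1"
    by (subst (asm) emeasure_density) simp_all
  show "integrable lborel g"
    by (rule integrableI_nonneg) (use nn I in auto)
  show "(\<integral>x. g x \<partial>lborel) = 1"
    by (subst integral_eq_nn_integral) (use nn I in auto)
qed

lemma integral_shift:
  fixes g :: "real \<Rightarrow> real"
  shows "(\<integral>y. g (y - t) \<partial>lborel) = (\<integral>y. g y \<partial>lborel)"
  using lborel_integral_real_affine[of 1 g "- t"] by (simp add: algebra_simps)

text \<open>With \<open>u = \<phi> (y - t) / \<phi> y\<close>, the inequality \<open>ln u \<le> 2 (sqrt u - 1)\<close>, multiplied by \<open>\<phi> y\<close>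
  and integrated over \<open>y\<close>, bounds \<open>B t - B 0\<close> by minus twice the affinity deficit; this
  deficit is nonnegative by the inequality of arithmetic and geometric means.\<close>

lemma B_fun_gap:
  assumes \<phi>: "is_density \<phi>" and B0: "B_finite \<phi> 0" and Bt: "B_finite \<phi> t"
  shows "B_fun \<phi> t \<le> B_fun \<phi> 0"
    and "1 \<le> hellinger_affinity \<phi> t + ennreal ((B_fun \<phi> 0 - B_fun \<phi> t) / 2)"
proof -
  note [measurable] = is_densityD(1)[OF \<phi>]
  note nn = is_densityD(2)[OF \<phi>] and int = is_densityD(4)[OF \<phi>] and one = is_densityD(5)[OF \<phi>]
  define r where "r y = sqrt (\<phi> y * \<phi> (y - t))" for y
  have [measurable]: "r \<in> borel_measurable borel"
    unfolding r_def by measurable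
  have r0: "0 \<le> r y" for y
    by (simp add: r_def nn)
  have r_le: "r y \<le> (\<phi> y + \<phi> (y - t)) / 2" for y
    unfolding r_def by (rule arith_geo_mean_sqrt) (auto simp: nn)
  have int_shift: "integrable lborel (\<lambda>y. \<phi> (y - t))"
    using lborel_integrable_real_affine[OF int, of 1 "- t"] by (simp add: algebra_simps)
  have int_r: "integrable lborel r"
  proof (rule Bochner_Integration.integrable_bound)
    show "integrable lborel (\<lambda>y. (\<phi> y + \<phi> (y - t)) / 2)"
      using int int_shift by simp
    show "AE y in lborel. norm (r y) \<le> norm ((\<phi> y + \<phi> (y - t)) / 2)"
      using r0 r_le nn by (intro AE_I2) (simp add: order_trans[OF r_le])
  qed simp
  have "(\<integral>y. r y \<partial>lborel) \<le> (\<integral>y. (\<phi> y + \<phi> (y - t)) / 2 \<partial>lborel)"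
    by (rule integral_mono) (use int_r int int_shift r_le in auto)
  also have "\<dots> = 1"
    using int int_shift one integral_shift[of \<phi> t] by simp
  finally have r_le_1: "(\<integral>y. r y \<partial>lborel) \<le> 1" .
  have i0: "integrable lborel (\<lambda>y. \<phi> y * ln (\<phi> y))"
    and it: "integrable lborel (\<lambda>y. \<phi> y * ln (\<phi> (y - t)))"
    and pos: "AE y in lborel. \<phi> y > 0 \<longrightarrow> \<phi> (y - t) > 0"
    using B0 Bt by (auto simp: B_finite_def)
  have pointwise: "\<phi> y * ln (\<phi> (y - t)) - \<phi> y * ln (\<phi> y) \<le> 2 * (r y - \<phi> y)"
    if "\<phi> y > 0 \<longrightarrow> \<phi> (y - t) > 0" for y
  proof (cases "\<phi> y = 0")
    case True
    then show ?thesis by (simp add: r_def)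
  next
    case False
    with nn[of y] have p: "\<phi> y > 0" by simp
    with that have q: "\<phi> (y - t) > 0" by simp
    define s where "s = sqrt (\<phi> (y - t) / \<phi> y)"
    have s: "s > 0" using p q by (simp add: s_def)
    have "\<phi> y * s = r y"
      using p q real_sqrt_mult_self[of "\<phi> y"] by (simp add: s_def r_def real_sqrt_divide real_sqrt_mult field_simps)
    moreover have "ln (\<phi> (y - t)) - ln (\<phi> y) = 2 * ln s"
      using p q by (simp add: s_def ln_sqrt ln_div)
    moreover have "\<phi> y * (2 * ln s) \<le> \<phi> y * (2 * (s - 1))"
      using p s ln_le_minus_one[OF s] by (intro mult_left_mono) auto
    ultimately show ?thesis
      by (simp add: algebra_simps flip: right_diff_distrib)
  qed
  have "B_fun \<phi> t - B_fun \<phi> 0 = (\<integral>y. \<phi> y * ln (\<phi> (y - t)) - \<phi> y * ln (\<phi> y) \<partial>lborel)"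
    using i0 it by (simp add: B_fun_def)
  also have "\<dots> \<le> (\<integral>y. 2 * (r y - \<phi> y) \<partial>lborel)"
    by (rule integral_mono_AE) (use i0 it int_r int pos pointwise in auto)
  also have "\<dots> = 2 * ((\<integral>y. r y \<partial>lborel) - 1)"
    using int_r int one by simp
  finally have gap: "2 * (1 - (\<integral>y. r y \<partial>lborel)) \<le> B_fun \<phi> 0 - B_fun \<phi> t"
    by simp
  show le: "B_fun \<phi> t \<le> B_fun \<phi> 0"
    using order_trans[OF _ gap, of 0] r_le_1 by simp
  define I where "I = (\<integral>y. r y \<partial>lborel)"
  have "hellinger_affinity \<phi> t = ennreal I"
    unfolding hellinger_affinity_def r_def[symmetric] I_def
    by (rule nn_integral_eq_integral[OF int_r]) (use r0 in auto)
  moreover have "0 \<le> I"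
    using r0 by (simp add: I_def)
  moreover have "1 \<le> I + (B_fun \<phi> 0 - B_fun \<phi> t) / 2"
    using gap[folded I_def] by argo
  ultimately show "1 \<le> hellinger_affinity \<phi> t + ennreal ((B_fun \<phi> 0 - B_fun \<phi> t) / 2)"
    using le by (simp flip: ennreal_plus)
qed

text \<open>By \<open>B_fun_gap\<close> the function \<open>B\<close> has a local maximum at \<open>0\<close>, so its derivative vanishes there and
  is at most \<open>C \<bar>s\<bar>\<close> at nearby \<open>s\<close>; this gives the quadratic bound for \<open>\<bar>t\<bar> < \<epsilon>\<close>. For
  larger \<open>t\<close> the term \<open>t\<^sup>2 / \<epsilon>\<^sup>2\<close> alone exceeds \<open>1\<close>, whether or not \<open>B t\<close> is finite.\<close>

lemma hellinger_deficit_quadratic: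
  assumes \<phi>: "is_density \<phi>" and B: "B_smooth_near_0 \<phi>"
  obtains K where "K > 0" and "\<And>t. 1 \<le> hellinger_affinity \<phi> t + ennreal (K * t\<^sup>2)"
proof -
  obtain \<epsilon> C where \<epsilon>: "\<epsilon> > 0"
    and fin: "\<And>t. \<bar>t\<bar> < \<epsilon> \<Longrightarrow> B_finite \<phi> t"
    and diff: "\<And>t. \<bar>t\<bar> < \<epsilon> \<Longrightarrow> B_fun \<phi> differentiable (at t)"
    and lip: "C-lipschitz_on {-\<epsilon><..<\<epsilon>} (deriv (B_fun \<phi>))"
    using B unfolding B_smooth_near_0_def by (auto simp: abs_less_iff)
  have C0: "C \<ge> 0" using lip by (rule lipschitz_on_nonneg)
  have der: "(B_fun \<phi> has_field_derivative deriv (B_fun \<phi>) t) (at t)" if "\<bar>t\<bar> < \<epsilon>" for t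
    using diff[OF that] by (simp add: DERIV_deriv_iff_real_differentiable)
  have der0: "deriv (B_fun \<phi>) 0 = 0"
  proof (rule DERIV_local_max)
    show "DERIV (B_fun \<phi>) 0 :> deriv (B_fun \<phi>) 0" using der[of 0] \<epsilon> by simp
    show "0 < \<epsilon>" by (rule \<epsilon>)
    show "\<forall>y. \<bar>0 - y\<bar> < \<epsilon> \<longrightarrow> B_fun \<phi> y \<le> B_fun \<phi> 0"
      using B_fun_gap(1)[OF \<phi> fin fin] \<epsilon> by simp
  qed
  have near: "B_fun \<phi> 0 - B_fun \<phi> t \<le> C * t\<^sup>2" if t: "\<bar>t\<bar> < \<epsilon>" for t
  proof -
    have "norm (B_fun \<phi> 0 - B_fun \<phi> t) \<le> (C * \<bar>t\<bar>) * norm (0 - t)"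
    proof (rule field_differentiable_bound)
      show "convex {-\<bar>t\<bar>..\<bar>t\<bar>}" by simp
      fix s assume s: "s \<in> {-\<bar>t\<bar>..\<bar>t\<bar>}"
      then have s': "\<bar>s\<bar> < \<epsilon>" "\<bar>s\<bar> \<le> \<bar>t\<bar>" using t by auto
      show "(B_fun \<phi> has_field_derivative deriv (B_fun \<phi>) s) (at s within {-\<bar>t\<bar>..\<bar>t\<bar>})"
        using der[OF s'(1)] by (rule has_field_derivative_at_within)
      have "dist (deriv (B_fun \<phi>) s) (deriv (B_fun \<phi>) 0) \<le> C * dist s 0"
        using s' \<epsilon> by (intro lipschitz_onD[OF lip]) (auto simp: abs_less_iff)
      then have "norm (deriv (B_fun \<phi>) s) \<le> C * \<bar>s\<bar>"
        by (simp add: der0 dist_norm)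
      also have "\<dots> \<le> C * \<bar>t\<bar>" using s' C0 by (intro mult_left_mono) auto
      finally show "norm (deriv (B_fun \<phi>) s) \<le> C * \<bar>t\<bar>" .
    qed auto
    then show ?thesis by (simp add: power2_eq_square mult.assoc)
  qed
  define K where "K = C + 1 / \<epsilon>\<^sup>2"
  show thesis
  proof (rule that[of K])
    show "K > 0" using C0 \<epsilon> by (simp add: K_def add_nonneg_pos)
    fix t
    show "1 \<le> hellinger_affinity \<phi> t + ennreal (K * t\<^sup>2)"
    proof (cases "\<bar>t\<bar> < \<epsilon>")
      case True
      have "(B_fun \<phi> 0 - B_fun \<phi> t) / 2 \<le> C * t\<^sup>2"
        using near[OF True] B_fun_gap(1)[OF \<phi> fin fin, of t] True \<epsilon> by simp
      also have "\<dots> \<le> K * t\<^sup>2"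
        using \<epsilon> by (intro mult_right_mono) (auto simp: K_def)
      finally have "ennreal ((B_fun \<phi> 0 - B_fun \<phi> t) / 2) \<le> ennreal (K * t\<^sup>2)"
        by (rule ennreal_leI)
      then show ?thesis
        using B_fun_gap(2)[OF \<phi> fin fin, of t] True \<epsilon>
        by (auto intro: order_trans[OF _ add_left_mono])
    next
      case False
      then have "\<epsilon>\<^sup>2 \<le> t\<^sup>2" using \<epsilon> by (auto simp flip: abs_le_square_iff)
      then have "1 \<le> 1 / \<epsilon>\<^sup>2 * t\<^sup>2" using \<epsilon> by (simp add: field_simps)
      also have "\<dots> \<le> K * t\<^sup>2" using C0 by (intro mult_right_mono) (auto simp: K_def)
      finally have "1 \<le> ennreal (K * t\<^sup>2)"
        by (metis ennreal_1 ennreal_leI)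
      then show ?thesis by (rule add_increasing[OF zero_le])
    qed
  qed
qed

section \<open>Le Cam's two-point method\<close>

lemma PiM_density:
  assumes M: "sigma_finite_measure M" and I: "finite I"
    and p[measurable]: "p \<in> borel_measurable M" and D: "sigma_finite_measure (density M p)"
  shows "PiM I (\<lambda>_. density M p) = density (PiM I (\<lambda>_. M)) (\<lambda>\<omega>. \<Prod>i\<in>I. p (\<omega> i))"
proof -
  interpret N: product_sigma_finite "\<lambda>_. M"
    using M by (simp add: product_sigma_finite_def)
  interpret P: product_sigma_finite "\<lambda>_. density M p"
    using D by (simp add: product_sigma_finite_def)
  have "density (PiM I (\<lambda>_. M)) (\<lambda>\<omega>. \<Prod>i\<in>I. p (\<omega> i)) = PiM I (\<lambda>_. density M p)"
  proof (rule P.PiM_eqI[OF I])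
    show "sets (density (PiM I (\<lambda>_. M)) (\<lambda>\<omega>. \<Prod>i\<in>I. p (\<omega> i))) = sets (PiM I (\<lambda>_. density M p))"
      by (auto intro!: sets_PiM_cong)
    fix A assume A: "\<And>i. i \<in> I \<Longrightarrow> A i \<in> sets (density M p)"
    then have [measurable]: "A i \<in> sets M" if "i \<in> I" for i using that by simp
    have "emeasure (density (PiM I (\<lambda>_. M)) (\<lambda>\<omega>. \<Prod>i\<in>I. p (\<omega> i))) (Pi\<^sub>E I A) =
        (\<integral>\<^sup>+ \<omega>. (\<Prod>i\<in>I. p (\<omega> i)) * indicator (Pi\<^sub>E I A) \<omega> \<partial>PiM I (\<lambda>_. M))"
      using I A by (intro emeasure_density) (auto intro!: sets_PiM_I_finite)
    also have "\<dots> = (\<integral>\<^sup>+ \<omega>. (\<Prod>i\<in>I. p (\<omega> i) * indicator (A i) (\<omega> i)) \<partial>PiM I (\<lambda>_. M))"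
    proof (rule nn_integral_cong)
      fix \<omega> assume "\<omega> \<in> space (PiM I (\<lambda>_. M))"
      then have "\<omega> \<in> Pi\<^sub>E I A \<longleftrightarrow> (\<forall>i\<in>I. \<omega> i \<in> A i)"
        by (auto simp: space_PiM PiE_iff)
      then show "(\<Prod>i\<in>I. p (\<omega> i)) * indicator (Pi\<^sub>E I A) \<omega> =
          (\<Prod>i\<in>I. p (\<omega> i) * indicator (A i) (\<omega> i))"
        using I by (auto simp: prod.distrib indicator_def prod_zero_iff)
    qed
    also have "\<dots> = (\<Prod>i\<in>I. \<integral>\<^sup>+ x. p x * indicator (A i) x \<partial>M)"
      by (rule N.product_nn_integral_prod[OF I]) measurable
    also have "\<dots> = (\<Prod>i\<in>I. emeasure (density M p) (A i))"
      by (intro prod.cong refl) (simp add: emeasure_density)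
    finally show "emeasure (density (PiM I (\<lambda>_. M)) (\<lambda>\<omega>. \<Prod>i\<in>I. p (\<omega> i))) (Pi\<^sub>E I A) =
        (\<Prod>i\<in>I. emeasure (density M p) (A i))" .
  qed
  then show ?thesis by simp
qed

text \<open>The triangle inequality bounds the sum of the two risks below by \<open>\<bar>a - b\<bar> * \<integral> min p q\<close>.
  Since \<open>sqrt (p q)\<close> is the geometric mean of the minimum and the maximum of \<open>p\<close> and \<open>q\<close>,
  an affinity of at least \<open>1 / 2\<close> forces \<open>\<integral> min p q \<ge> 1 / 8\<close>.\<close>

lemma two_point_lower_bound:
  fixes T :: "'a \<Rightarrow> real" and p q :: "'a \<Rightarrow> real"
  assumes [measurable]: "T \<in> borel_measurable N" "p \<in> borel_measurable N" "q \<in> borel_measurable N"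
    and nn: "\<And>s. 0 \<le> p s" "\<And>s. 0 \<le> q s"
    and p1: "(\<integral>\<^sup>+ s. ennreal (p s) \<partial>N) = 1" and q1: "(\<integral>\<^sup>+ s. ennreal (q s) \<partial>N) = 1"
    and aff: "ennreal (1 / 2) \<le> (\<integral>\<^sup>+ s. ennreal (sqrt (p s * q s)) \<partial>N)"
  shows "ennreal (\<bar>a - b\<bar> / 16) \<le>
    max (\<integral>\<^sup>+ s. ennreal \<bar>T s - a\<bar> \<partial>density N (\<lambda>s. ennreal (p s)))
        (\<integral>\<^sup>+ s. ennreal \<bar>T s - b\<bar> \<partial>density N (\<lambda>s. ennreal (q s)))"
proof -
  define m where "m = (\<integral>\<^sup>+ s. ennreal (min (p s) (q s)) \<partial>N)"
  \<comment> \<open>The weights \<open>1 / 4\<close> and \<open>4\<close> in the arithmetic mean are chosen so that \<open>max p q\<close>, whose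
    integral can be as large as \<open>2\<close>, contributes only half of the total \<open>1\<close> on the left.\<close>
  have amgm: "2 * sqrt (p s * q s) \<le> (p s + q s) / 4 + 4 * min (p s) (q s)" for s
  proof -
    have "sqrt (p s * q s) = sqrt ((max (p s) (q s) / 4) * (4 * min (p s) (q s)))"
      by (auto simp: max_def min_def mult.commute)
    also have "\<dots> \<le> (max (p s) (q s) / 4 + 4 * min (p s) (q s)) / 2"
      using nn[of s] by (intro arith_geo_mean_sqrt) (auto simp: max_def min_def)
    also have "\<dots> \<le> ((p s + q s) / 4 + 4 * min (p s) (q s)) / 2"
      using nn[of s] by (auto simp: max_def)
    finally show ?thesis by simp
  qed
  have m_le: "m \<le> 1"
    unfolding m_def p1[symmetric] by (intro nn_integral_mono ennreal_leI) simp
  have "1 \<le> (\<integral>\<^sup>+ s. 2 * ennreal (sqrt (p s * q s)) \<partial>N)"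
  proof -
    have "1 = ennreal 2 * ennreal (1 / 2)"
      by (subst ennreal_mult'[symmetric]) simp_all
    also have "\<dots> \<le> ennreal 2 * (\<integral>\<^sup>+ s. ennreal (sqrt (p s * q s)) \<partial>N)"
      using aff by (rule mult_left_mono) simp
    finally show ?thesis by (simp add: nn_integral_cmult)
  qed
  also have "\<dots> \<le> (\<integral>\<^sup>+ s. ennreal (1 / 4) * (ennreal (p s) + ennreal (q s))
      + 4 * ennreal (min (p s) (q s)) \<partial>N)"
  proof (rule nn_integral_mono)
    fix s
    have "2 * ennreal (sqrt (p s * q s)) = ennreal (2 * sqrt (p s * q s))"
      using nn[of s] by (simp add: ennreal_mult)
    also have "\<dots> \<le> ennreal ((p s + q s) / 4 + 4 * min (p s) (q s))"
      by (rule ennreal_leI) (rule amgm)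
    also have "\<dots> = ennreal (1 / 4) * (ennreal (p s) + ennreal (q s))
        + 4 * ennreal (min (p s) (q s))"
      using nn[of s]
      by (simp add: ennreal_mult'[symmetric] flip: ennreal_plus ennreal_numeral)
    finally show "2 * ennreal (sqrt (p s * q s)) \<le> \<dots>" .
  qed
  also have "\<dots> = ennreal (1 / 4) * (1 + 1) + 4 * m"
    by (simp add: nn_integral_add nn_integral_cmult p1 q1 m_def)
  finally have le_m: "1 \<le> ennreal (1 / 4) * (1 + 1) + 4 * m" .
  obtain mr where mr: "m = ennreal mr" "0 \<le> mr"
    using m_le by (cases m) (auto simp: top_unique)
  have "ennreal (1 / 4) * (1 + 1) + 4 * m = ennreal (1 / 4) * ennreal 2 + ennreal 4 * ennreal mr"
    by (simp add: mr)
  also have "\<dots> = ennreal (1 / 4 * 2) + ennreal (4 * mr)"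
    by (subst (1 2) ennreal_mult') simp_all
  also have "\<dots> = ennreal (1 / 4 * 2 + 4 * mr)"
    using mr by (intro ennreal_plus[symmetric]) auto
  finally have "1 \<le> ennreal (1 / 4 * 2 + 4 * mr)"
    using le_m by argo
  then have "1 \<le> 1 / 4 * 2 + 4 * mr"
    unfolding ennreal_1[symmetric] using mr(2) by (subst (asm) ennreal_le_iff) auto
  then have mr_ge: "1 / 8 \<le> mr" by simp
  define x where "x = (\<integral>\<^sup>+ s. ennreal \<bar>T s - a\<bar> \<partial>density N (\<lambda>s. ennreal (p s)))"
  define y where "y = (\<integral>\<^sup>+ s. ennreal \<bar>T s - b\<bar> \<partial>density N (\<lambda>s. ennreal (q s)))"
  have "ennreal (\<bar>a - b\<bar> / 8) \<le> ennreal (\<bar>a - b\<bar>) * m"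
    unfolding mr using mult_left_mono[OF mr_ge, of "\<bar>a - b\<bar>"] mr
    by (simp add: ennreal_mult'[symmetric])
  also have "\<dots> = (\<integral>\<^sup>+ s. ennreal \<bar>a - b\<bar> * ennreal (min (p s) (q s)) \<partial>N)"
    by (simp add: m_def nn_integral_cmult)
  also have "\<dots> \<le> (\<integral>\<^sup>+ s. ennreal (p s) * ennreal \<bar>T s - a\<bar> + ennreal (q s) * ennreal \<bar>T s - b\<bar> \<partial>N)"
  proof (rule nn_integral_mono)
    fix s
    have "\<bar>a - b\<bar> * min (p s) (q s) \<le> (\<bar>T s - a\<bar> + \<bar>T s - b\<bar>) * min (p s) (q s)"
      using nn[of s] by (intro mult_right_mono) auto
    also have "\<dots> \<le> p s * \<bar>T s - a\<bar> + q s * \<bar>T s - b\<bar>"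
      using mult_left_mono[of "min (p s) (q s)" "p s" "\<bar>T s - a\<bar>"]
        mult_left_mono[of "min (p s) (q s)" "q s" "\<bar>T s - b\<bar>"]
      by (simp add: algebra_simps)
    finally have le: "\<bar>a - b\<bar> * min (p s) (q s) \<le> p s * \<bar>T s - a\<bar> + q s * \<bar>T s - b\<bar>" .
    have "ennreal \<bar>a - b\<bar> * ennreal (min (p s) (q s)) = ennreal (\<bar>a - b\<bar> * min (p s) (q s))"
      by (rule ennreal_mult'[symmetric]) simp
    also have "\<dots> \<le> ennreal (p s * \<bar>T s - a\<bar> + q s * \<bar>T s - b\<bar>)"
      by (rule ennreal_leI) (rule le)
    also have "\<dots> = ennreal (p s) * ennreal \<bar>T s - a\<bar> + ennreal (q s) * ennreal \<bar>T s - b\<bar>"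
      using nn[of s] by (simp add: ennreal_mult)
    finally show "ennreal \<bar>a - b\<bar> * ennreal (min (p s) (q s)) \<le> \<dots>" .
  qed
  also have "\<dots> = x + y"
    by (simp add: x_def y_def nn_integral_density nn_integral_add)
  also have "\<dots> \<le> max x y + max x y"
    by (intro add_mono) auto
  finally have le: "ennreal (\<bar>a - b\<bar> / 8) \<le> max x y + max x y" .
  have "ennreal (\<bar>a - b\<bar> / 16) \<le> max x y"
  proof (cases "max x y")
    case (real z)
    with le have "\<bar>a - b\<bar> / 8 \<le> z + z" by (simp flip: ennreal_plus)
    then have "\<bar>a - b\<bar> / 16 \<le> z" by simp
    with real show ?thesis by (simp add: ennreal_leI)
  qed simp
  then show ?thesis by (simp add: x_def y_def)
qed

section \<open>Two-point bound for the template matching model\<close>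

lemma hellinger_affinity_shift:
  assumes \<phi>: "is_density \<phi>"
  shows "(\<integral>\<^sup>+ y. ennreal (sqrt (\<phi> (y - a) * \<phi> (y - b))) \<partial>lborel) = hellinger_affinity \<phi> (b - a)"
proof -
  note [measurable] = is_densityD(1)[OF \<phi>]
  show ?thesis
    unfolding hellinger_affinity_def
    by (subst nn_integral_real_affine[of _ 1 a]) (auto simp: algebra_simps)
qed

lemma density_obs_integral:
  assumes lam: "is_density lam" and \<phi>: "is_density \<phi>" and [measurable]: "f \<in> borel_measurable borel"
  shows "(\<integral>\<^sup>+ (x, y). ennreal (lam x * \<phi> (y - f (x - \<theta>))) \<partial>lborel) = 1"
proof -
  note [measurable] = is_densityD(1)[OF \<phi>] is_densityD(1)[OF lam]
  note nn = is_densityD(2)[OF \<phi>] is_densityD(2)[OF lam]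
  have one: "(\<integral>\<^sup>+ y. ennreal (\<phi> (y - c)) \<partial>lborel) = 1" for c
    using nn_integral_real_affine[of "\<lambda>y. ennreal (\<phi> y)" 1 "- c"] is_densityD(3)[OF \<phi>]
    by (simp add: algebra_simps)
  have "(\<integral>\<^sup>+ (x, y). ennreal (lam x * \<phi> (y - f (x - \<theta>))) \<partial>lborel) =
      (\<integral>\<^sup>+ x. \<integral>\<^sup>+ y. ennreal (lam x * \<phi> (y - f (x - \<theta>))) \<partial>lborel \<partial>lborel)"
    by (subst lborel.nn_integral_fst[symmetric, of _ lborel, unfolded lborel_prod]) (simp_all flip: lborel_prod)
  also have "\<dots> = (\<integral>\<^sup>+ x. ennreal (lam x) \<partial>lborel)"
    by (simp add: ennreal_mult nn nn_integral_cmult one)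
  finally show ?thesis by (simp add: is_densityD(3)[OF lam])
qed

text \<open>The bound \<open>w\<close> on the conditional affinity deficit may depend on the design point, so that a
  small set of design points where \<open>f\<close> jumps between the two shifts can be given the trivial
  bound \<open>1\<close>; only the average of \<open>w\<close> under the design law matters.\<close>

lemma obs_affinity:
  assumes lam: "is_density lam" and \<phi>: "is_density \<phi>"
    and [measurable]: "f \<in> borel_measurable borel" "w \<in> borel_measurable borel"
    and deficit: "\<And>x. lam x \<noteq> 0 \<Longrightarrow> 1 \<le> hellinger_affinity \<phi> (f (x - b) - f (x - a)) + w x"
    and small: "(\<integral>\<^sup>+ x. ennreal (lam x) * w x \<partial>lborel) \<le> ennreal \<kappa>"
    and \<kappa>: "0 \<le> \<kappa>" "\<kappa> \<le> 1"
  shows "ennreal (1 - \<kappa>) \<le> (\<integral>\<^sup>+ (x, y). ennreal (sqrt ((lam x * \<phi> (y - f (x - a))) *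
     (lam x * \<phi> (y - f (x - b))))) \<partial>lborel)" (is "_ \<le> ?aff")
proof -
  note [measurable] = is_densityD(1)[OF \<phi>] is_densityD(1)[OF lam]
  note nn = is_densityD(2)[OF \<phi>] is_densityD(2)[OF lam]
  have split: "sqrt ((lam x * u) * (lam x * v)) = lam x * sqrt (u * v)" for x u v
    using nn(2)[of x] by (simp add: real_sqrt_mult)
  have [measurable]: "(\<lambda>x. hellinger_affinity \<phi> (f (x - b) - f (x - a))) \<in> borel_measurable borel"
    unfolding hellinger_affinity_def by measurable
  have aff: "?aff = (\<integral>\<^sup>+ x. ennreal (lam x) * hellinger_affinity \<phi> (f (x - b) - f (x - a)) \<partial>lborel)"
    unfolding split
    by (subst lborel.nn_integral_fst[symmetric, of _ lborel, unfolded lborel_prod])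
      (simp_all add: ennreal_mult nn nn_integral_cmult hellinger_affinity_shift[OF \<phi>] flip: lborel_prod)
  have "1 = (\<integral>\<^sup>+ x. ennreal (lam x) \<partial>lborel)"
    by (simp add: is_densityD(3)[OF lam])
  also have "\<dots> \<le> (\<integral>\<^sup>+ x. ennreal (lam x) * hellinger_affinity \<phi> (f (x - b) - f (x - a))
      + ennreal (lam x) * w x \<partial>lborel)"
  proof (rule nn_integral_mono)
    fix x
    show "ennreal (lam x) \<le> ennreal (lam x) * hellinger_affinity \<phi> (f (x - b) - f (x - a))
      + ennreal (lam x) * w x"
      using deficit[of x] mult_left_mono[of 1 "hellinger_affinity \<phi> (f (x - b) - f (x - a)) + w x" "ennreal (lam x)"]
      by (cases "lam x = 0") (auto simp: distrib_left)
  qed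
  also have "\<dots> = ?aff + (\<integral>\<^sup>+ x. ennreal (lam x) * w x \<partial>lborel)"
    unfolding aff by (rule nn_integral_add) auto
  also have "\<dots> \<le> ?aff + ennreal \<kappa>"
    using small by (rule add_left_mono)
  finally have le: "1 \<le> ?aff + ennreal \<kappa>" .
  show ?thesis
  proof (cases ?aff)
    case (real z)
    with le \<kappa> have "1 \<le> z + \<kappa>" by (simp flip: ennreal_plus ennreal_1)
    with real show ?thesis by (simp add: ennreal_leI)
  qed simp
qed

lemma minimax_risk_two_point:
  assumes lam: "is_density lam" and \<phi>: "is_density \<phi>"
    and f[measurable]: "f \<in> borel_measurable borel" and w: "w \<in> borel_measurable borel"
    and deficit: "\<And>x. lam x \<noteq> 0 \<Longrightarrow> 1 \<le> hellinger_affinity \<phi> (f (x - b) - f (x - a)) + w x"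
    and small: "(\<integral>\<^sup>+ x. ennreal (lam x) * w x \<partial>lborel) \<le> ennreal (1 / (2 * real n))"
    and n: "n \<ge> 1" and ab: "a \<in> \<Theta>" "b \<in> \<Theta>"
  shows "ennreal (\<bar>a - b\<bar> / 16) \<le> minimax_risk f lam \<phi> \<Theta> n"
proof -
  note [measurable] = is_densityD(1)[OF \<phi>] is_densityD(1)[OF lam]
  note nn = is_densityD(2)[OF \<phi>] is_densityD(2)[OF lam]
  define g where "g \<theta> = (\<lambda>z. lam (fst z) * \<phi> (snd z - f (fst z - \<theta>)))" for \<theta>
  have gm[measurable]: "g \<theta> \<in> borel_measurable borel" for \<theta>
    unfolding g_def borel_prod[symmetric] by measurable
  have g0: "0 \<le> g \<theta> z" for \<theta> z by (simp add: g_def nn)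
  have g1: "(\<integral>\<^sup>+ z. ennreal (g \<theta> z) \<partial>lborel) = 1" for \<theta>
    using density_obs_integral[OF lam \<phi> f, of \<theta>] by (simp add: g_def split_beta')
  interpret product_sigma_finite "\<lambda>_::nat. lborel :: (real \<times> real) measure"
    by unfold_locales
  define N where "N = PiM {..<n} (\<lambda>_. lborel :: (real \<times> real) measure)"
  define p where "p \<theta> = (\<lambda>s. \<Prod>i<n. g \<theta> (s i))" for \<theta>
  have p0: "0 \<le> p \<theta> s" for \<theta> s by (auto simp: p_def intro!: prod_nonneg g0)
  have [measurable]: "p \<theta> \<in> borel_measurable N" for \<theta>
    unfolding p_def N_def by measurable
  have law: "sample_law f lam \<phi> n \<theta> = density N (\<lambda>s. ennreal (p \<theta> s))" for \<theta>
  proof -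
    have "prob_space (density lborel (\<lambda>z. ennreal (g \<theta> z)))"
      by (rule prob_spaceI) (simp add: emeasure_density g1)
    then interpret D: prob_space "density lborel (\<lambda>z. ennreal (g \<theta> z))" .
    have "obs_law f lam \<phi> \<theta> = density lborel (\<lambda>z. ennreal (g \<theta> z))"
      by (simp add: obs_law_def g_def split_beta')
    then show ?thesis
      unfolding sample_law_def N_def
      by (simp add: PiM_density[OF lborel.sigma_finite_measure_axioms _ _ D.sigma_finite_measure_axioms]
          p_def prod_ennreal g0)
  qed
  have p1: "(\<integral>\<^sup>+ s. ennreal (p \<theta> s) \<partial>N) = 1" for \<theta>
    using product_nn_integral_prod[of "{..<n}" "\<lambda>_ z. ennreal (g \<theta> z)"]
    by (simp add: p_def N_def prod_ennreal g0 g1)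
  have sqrt_prod: "sqrt (\<Prod>i\<in>I. h i) = (\<Prod>i\<in>I. sqrt (h i))" for I :: "nat set" and h
    by (induction I rule: infinite_finite_induct) (auto simp: real_sqrt_mult)
  define aff where "aff = (\<integral>\<^sup>+ z. ennreal (sqrt (g a z * g b z)) \<partial>lborel)"
  have "ennreal (1 - 1 / (2 * real n)) \<le> aff"
    using obs_affinity[OF lam \<phi> f w deficit small] n
    by (simp add: aff_def g_def split_beta')
  then have "ennreal (1 - 1 / (2 * real n)) ^ n \<le> aff ^ n"
    by (rule power_mono) simp
  also have "aff ^ n = (\<integral>\<^sup>+ s. ennreal (sqrt (p a s * p b s)) \<partial>N)"
    using product_nn_integral_prod[of "{..<n}" "\<lambda>_ z. ennreal (sqrt (g a z * g b z))"]
    by (simp add: p_def N_def prod_ennreal g0 aff_def sqrt_prod flip: prod.distrib)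
  finally have "ennreal ((1 - 1 / (2 * real n)) ^ n) \<le> (\<integral>\<^sup>+ s. ennreal (sqrt (p a s * p b s)) \<partial>N)"
    using n by (simp add: ennreal_power)
  moreover have "1 / 2 \<le> (1 - 1 / (2 * real n)) ^ n"
    using Bernoulli_inequality[of "- (1 / (2 * real n))" n] n by (simp add: field_simps)
  ultimately have half: "ennreal (1 / 2) \<le> (\<integral>\<^sup>+ s. ennreal (sqrt (p a s * p b s)) \<partial>N)"
    by (meson ennreal_leI order_trans)
  show ?thesis
    unfolding minimax_risk_def
  proof (rule INF_greatest)
    fix T assume "T \<in> estimators n"
    moreover have "sets (PiM {..<n} (\<lambda>_. borel :: (real \<times> real) measure)) = sets N"
      unfolding N_def by (rule sets_PiM_cong) auto
    ultimately have T[measurable]: "T \<in> borel_measurable N"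
      unfolding estimators_def by (simp cong: measurable_cong_sets)
    have "ennreal (\<bar>a - b\<bar> / 16) \<le> max (risk f lam \<phi> n T a) (risk f lam \<phi> n T b)"
      unfolding risk_def law
      by (rule two_point_lower_bound) (use p0 p1 half in auto)
    also have "\<dots> \<le> (SUP \<theta>\<in>\<Theta>. risk f lam \<phi> n T \<theta>)"
      using ab by (auto intro: SUP_upper)
    finally show "ennreal (\<bar>a - b\<bar> / 16) \<le> (SUP \<theta>\<in>\<Theta>. risk f lam \<phi> n T \<theta>)" .
  qed
qed

section \<open>Choice of the base shift\<close>

text \<open>By Tonelli, \<open>\<integral> P (X - \<theta> \<in> S) d\<theta>\<close> over the whole line is the Lebesgue measure of \<open>S\<close>,
  so \<open>P (X - \<theta> \<in> S)\<close> cannot exceed \<open>c\<close> throughout an interval of length \<open>A\<close>.\<close>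

lemma exists_light_shift:
  assumes lam: "is_density lam" and [measurable]: "S \<in> sets borel"
    and A: "A > 0" and S: "emeasure lborel S < ennreal (c * A)"
  obtains \<theta> where "\<theta> \<in> {0..A}" "(\<integral>\<^sup>+ x. ennreal (lam x) * indicator S (x - \<theta>) \<partial>lborel) \<le> ennreal c"
proof (rule ccontr)
  note [measurable] = is_densityD(1)[OF lam]
  assume "\<not> thesis"
  with that have heavy: "ennreal c \<le> (\<integral>\<^sup>+ x. ennreal (lam x) * indicator S (x - \<theta>) \<partial>lborel)"
    if "\<theta> \<in> {0..A}" for \<theta>
    using \<open>\<theta> \<in> {0..A}\<close> by (meson linear)
  have reflect: "(\<integral>\<^sup>+ \<theta>. indicator S (x - \<theta>) \<partial>lborel) = emeasure lborel S" for x
    using nn_integral_real_affine[of "indicator S" "-1" x] by simp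
  have "c > 0"
    using S A by (metis ennreal_neg linorder_not_less mult_nonpos_nonneg not_less_zero less_imp_le)
  then have "ennreal (c * A) = (\<integral>\<^sup>+ \<theta>. ennreal c * indicator {0..A} \<theta> \<partial>lborel)"
    using A by (simp add: nn_integral_cmult_indicator ennreal_mult)
  also have "\<dots> \<le> (\<integral>\<^sup>+ \<theta>. \<integral>\<^sup>+ x. ennreal (lam x) * indicator S (x - \<theta>) \<partial>lborel \<partial>lborel)"
    by (rule nn_integral_mono) (use heavy in \<open>auto simp: indicator_def\<close>)
  also have "\<dots> = (\<integral>\<^sup>+ x. \<integral>\<^sup>+ \<theta>. ennreal (lam x) * indicator S (x - \<theta>) \<partial>lborel \<partial>lborel)"
    by (rule lborel_pair.Fubini') measurable
  also have "\<dots> = (\<integral>\<^sup>+ x. ennreal (lam x) * emeasure lborel S \<partial>lborel)"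
    by (simp add: nn_integral_cmult reflect)
  also have "\<dots> = emeasure lborel S"
    by (simp add: nn_integral_multc is_densityD(3)[OF lam])
  finally show False using S by simp
qed

section \<open>Minimax rates\<close>

lemma finite_discontinuities_measurable:
  assumes "finite (discontinuities f)"
  shows "f \<in> borel_measurable borel"
proof (rule borel_measurable_continuous_countable_exceptions)
  show "countable (discontinuities f)" using assms by (rule countable_finite)
  show "continuous_on (- discontinuities f) f"
    by (rule continuous_at_imp_continuous_on) (simp add: discontinuities_def)
qed

lemma density_supported_interval_pos:
  assumes lam: "is_density lam" and supp: "{x. lam x \<noteq> 0} \<subseteq> {-A..A}"
  shows "0 < A"
proof (rule ccontr)
  assume "\<not> 0 < A"
  then have "lam x = 0" if "x \<noteq> 0" for x using supp that by force
  then have "AE x in lborel. ennreal (lam x) = 0"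
    using AE_lborel_singleton[of "0::real"] by (auto elim: eventually_mono)
  then have "(\<integral>\<^sup>+ x. ennreal (lam x) \<partial>lborel) = 0"
    by (subst nn_integral_cong_AE[where v = "\<lambda>_. 0"]) auto
  then show False using is_densityD(3)[OF lam] by simp
qed

text \<open>The shifts are \<open>0\<close> and \<open>\<Delta> = \<delta> / n powr (1 / (2 \<alpha>))\<close>. Since \<open>\<Delta> powr (2 \<alpha>) = \<delta> powr (2 \<alpha>) / n\<close>,
  a small constant \<open>\<delta>\<close> makes the deficit \<open>K * H\<^sup>2 * \<Delta> powr (2 \<alpha>)\<close> at most \<open>1 / (2 n)\<close> for all \<open>n\<close>
  at once.\<close>

lemma minimax_risk_holder:
  assumes lam: "is_density lam" and \<phi>: "is_density \<phi>" and f: "f \<in> borel_measurable borel"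
    and B: "B_smooth_near_0 \<phi>"
    and A: "0 < A" and \<alpha>: "0 < \<alpha>" and hol: "holder \<alpha> f"
  shows "\<exists>c::real. c > 0 \<and> (\<forall>n\<ge>1. ennreal c \<le>
    ennreal (real n powr (1 / (2 * \<alpha>))) * minimax_risk f lam \<phi> {-2*A..2*A} n)"
proof -
  obtain K where K: "K > 0" and deficit: "\<And>t. 1 \<le> hellinger_affinity \<phi> t + ennreal (K * t\<^sup>2)"
    using hellinger_deficit_quadratic[OF \<phi> B] by blast
  obtain H0 where H0: "\<And>x1 x2. x1 \<noteq> x2 \<Longrightarrow> \<bar>f x1 - f x2\<bar> / \<bar>x1 - x2\<bar> powr \<alpha> \<le> H0"
    using hol unfolding holder_def bdd_above_def by blast
  define H where "H = max 1 H0"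
  have H: "H > 0" by (simp add: H_def)
  have hold: "\<bar>f x1 - f x2\<bar> \<le> H * \<bar>x1 - x2\<bar> powr \<alpha>" if "x1 \<noteq> x2" for x1 x2
    using H0[OF that] that by (simp add: H_def field_simps max_def split: if_splits)
      (metis mult_right_mono order_trans powr_ge_zero mult_1 mult.commute nle_le)
  define \<delta> where "\<delta> = min (2 * A) ((1 / (2 * K * H\<^sup>2)) powr (1 / (2 * \<alpha>)))"
  have \<delta>: "\<delta> > 0" using A K H by (simp add: \<delta>_def)
  have "\<delta> powr (2 * \<alpha>) \<le> ((1 / (2 * K * H\<^sup>2)) powr (1 / (2 * \<alpha>))) powr (2 * \<alpha>)"
    using \<delta> \<alpha> by (intro powr_mono2) (auto simp: \<delta>_def)
  also have "\<dots> = 1 / (2 * K * H\<^sup>2)" using \<alpha> K H by (simp add: powr_powr)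
  finally have \<delta>_pow: "K * H\<^sup>2 * \<delta> powr (2 * \<alpha>) \<le> 1 / 2"
    using K H by (simp add: field_simps)
  have "ennreal (\<delta> / 16) \<le> ennreal (real n powr (1 / (2 * \<alpha>))) * minimax_risk f lam \<phi> {-2*A..2*A} n"
    if n: "n \<ge> 1" for n
  proof -
    define r where "r = real n powr (1 / (2 * \<alpha>))"
    have r1: "r \<ge> 1" using n \<alpha> by (simp add: r_def ge_one_powr_ge_zero)
    define \<Delta> where "\<Delta> = \<delta> / r"
    have \<Delta>: "0 < \<Delta>" "\<Delta> \<le> 2 * A"
    proof -
      show "0 < \<Delta>" using \<delta> r1 by (simp add: \<Delta>_def)
      have "\<Delta> \<le> \<delta>" using \<delta> r1 by (simp add: \<Delta>_def field_simps)
      then show "\<Delta> \<le> 2 * A" by (simp add: \<delta>_def)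
    qed
    have "\<Delta> powr (2 * \<alpha>) = \<delta> powr (2 * \<alpha>) / n"
      using \<delta> r1 \<alpha> n by (simp add: \<Delta>_def powr_divide r_def powr_powr)
    then have rate: "K * H\<^sup>2 * \<Delta> powr (2 * \<alpha>) \<le> 1 / (2 * real n)"
      using divide_right_mono[OF \<delta>_pow, of "real n"] by simp
    have "ennreal (\<bar>0 - \<Delta>\<bar> / 16) \<le> minimax_risk f lam \<phi> {-2*A..2*A} n"
    proof (rule minimax_risk_two_point[OF lam \<phi> f _ _ _ n, where w = "\<lambda>_. ennreal (1 / (2 * real n))"])
      fix x
      have "\<bar>f (x - \<Delta>) - f (x - 0)\<bar> \<le> H * \<Delta> powr \<alpha>"
        using hold[of "x - \<Delta>" "x - 0"] \<Delta> by simp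
      then have "\<bar>f (x - \<Delta>) - f (x - 0)\<bar>\<^sup>2 \<le> (H * \<Delta> powr \<alpha>)\<^sup>2"
        by (rule power_mono) simp
      also have "\<dots> = H\<^sup>2 * \<Delta> powr (2 * \<alpha>)"
        by (simp add: power_mult_distrib power2_eq_square flip: powr_add)
      finally have "K * (f (x - \<Delta>) - f (x - 0))\<^sup>2 \<le> K * (H\<^sup>2 * \<Delta> powr (2 * \<alpha>))"
        using K by (intro mult_left_mono) auto
      with rate have "K * (f (x - \<Delta>) - f (x - 0))\<^sup>2 \<le> 1 / (2 * real n)" by simp
      then show "1 \<le> hellinger_affinity \<phi> (f (x - \<Delta>) - f (x - 0)) + ennreal (1 / (2 * real n))"
        by (meson deficit order_trans add_left_mono ennreal_leI)
    qed (use A \<Delta> in \<open>auto simp: nn_integral_multc is_densityD[OF lam]\<close>)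
    then have "ennreal r * ennreal (\<Delta> / 16) \<le> ennreal r * minimax_risk f lam \<phi> {-2*A..2*A} n"
      using \<Delta> by (intro mult_left_mono) auto
    moreover have "ennreal r * ennreal (\<Delta> / 16) = ennreal (\<delta> / 16)"
      using r1 \<delta> by (simp add: \<Delta>_def flip: ennreal_mult')
    ultimately show ?thesis by (simp add: r_def)
  qed
  with \<delta> show ?thesis by (intro exI[of _ "\<delta> / 16"]) auto
qed

text \<open>The shifts are \<open>\<theta>\<close> and \<open>\<theta> + \<Delta>\<close> with \<open>\<Delta> = \<delta> / n\<close>. A discontinuity \<open>d\<close> of \<open>f\<close> lies between
  \<open>x - \<theta> - \<Delta>\<close> and \<open>x - \<theta>\<close> iff \<open>x - \<theta> \<in> {d..d + \<Delta>}\<close>; elsewhere the piecewise Hoelder bound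
  gives the deficit \<open>K * H\<^sup>2 * \<Delta> powr (2 \<alpha>) \<le> K * H\<^sup>2 * \<Delta>\<close>, because \<open>\<Delta> \<le> 1 \<le> 2 \<alpha>\<close>.\<close>

lemma minimax_risk_piecewise_holder:
  assumes lam: "is_density lam" and \<phi>: "is_density \<phi>"
    and fin: "finite (discontinuities f)" and B: "B_smooth_near_0 \<phi>"
    and A: "0 < A" and \<alpha>: "1 / 2 \<le> \<alpha>" and hol: "piecewise_holder \<alpha> f"
  shows "\<exists>c::real. c > 0 \<and> (\<forall>n\<ge>1. ennreal c \<le>
    ennreal (real n) * minimax_risk f lam \<phi> {-2*A..2*A} n)"
proof -
  note [measurable] = is_densityD(1)[OF lam]
  note f = finite_discontinuities_measurable[OF fin]
  obtain K where K: "K > 0" and deficit: "\<And>t. 1 \<le> hellinger_affinity \<phi> t + ennreal (K * t\<^sup>2)"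
    using hellinger_deficit_quadratic[OF \<phi> B] by blast
  obtain H where hold: "\<And>x1 x2. x1 \<le> x2 \<Longrightarrow> {x1..x2} \<inter> discontinuities f = {} \<Longrightarrow>
      \<bar>f x1 - f x2\<bar> \<le> H * \<bar>x1 - x2\<bar> powr \<alpha>"
    using hol unfolding piecewise_holder_def by blast
  \<comment> \<open>The intervals to avoid have total length at most \<open>card (discontinuities f) * \<Delta>\<close>; the
    additional \<open>1\<close> provides the strict inequality that \<open>exists_light_shift\<close> asks for.\<close>
  define c where "c = (real (card (discontinuities f)) + 1) / A"
  have c: "c > 0" using A by (simp add: c_def)
  define E where "E = K * H\<^sup>2 + c"
  have E: "E > 0" using K c by (simp add: E_def add_nonneg_pos)
  define \<delta> where "\<delta> = min 1 (min A (1 / (2 * E)))"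
  have \<delta>: "\<delta> > 0" using A E by (simp add: \<delta>_def)
  have \<delta>E: "E * \<delta> \<le> 1 / 2"
    using E mult_left_mono[of \<delta> "1 / (2 * E)" E] by (simp add: \<delta>_def)
  have "ennreal (\<delta> / 16) \<le> ennreal (real n) * minimax_risk f lam \<phi> {-2*A..2*A} n"
    if n: "n \<ge> 1" for n
  proof -
    define \<Delta> where "\<Delta> = \<delta> / real n"
    have \<Delta>0: "0 < \<Delta>" using \<delta> n by (simp add: \<Delta>_def)
    have "\<Delta> \<le> \<delta>" using \<delta> n by (simp add: \<Delta>_def field_simps)
    then have \<Delta>: "\<Delta> \<le> 1" "\<Delta> \<le> A" by (auto simp: \<delta>_def)
    have rate: "K * H\<^sup>2 * \<Delta> + c * \<Delta> \<le> 1 / (2 * real n)"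
      using divide_right_mono[OF \<delta>E, of "real n"] by (simp add: \<Delta>_def E_def distrib_right add_divide_distrib)
    define S where "S = (\<Union>d\<in>discontinuities f. {d..d + \<Delta>})"
    have [measurable]: "S \<in> sets borel"
      unfolding S_def using fin by (intro sets.finite_UN) auto
    have "emeasure lborel S \<le> (\<Sum>d\<in>discontinuities f. emeasure lborel {d..d + \<Delta>})"
      unfolding S_def using fin by (intro emeasure_subadditive_finite) auto
    also have "\<dots> = ennreal (real (card (discontinuities f)) * \<Delta>)"
      using \<Delta>0 by (simp add: ennreal_mult ennreal_of_nat_eq_real_of_nat)
    also have "\<dots> < ennreal (c * \<Delta> * A)"
      using \<Delta>0 A by (intro ennreal_lessI) (auto simp: c_def field_simps add_pos_nonneg)
    finally have "emeasure lborel S < ennreal (c * \<Delta> * A)" .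
    then obtain \<theta> where \<theta>: "\<theta> \<in> {0..A}"
      and light: "(\<integral>\<^sup>+ x. ennreal (lam x) * indicator S (x - \<theta>) \<partial>lborel) \<le> ennreal (c * \<Delta>)"
      by (rule exists_light_shift[OF lam \<open>S \<in> sets borel\<close> A])
    define w :: "real \<Rightarrow> ennreal"
      where "w x = ennreal (K * H\<^sup>2 * \<Delta>) + indicator S (x - \<theta>)" for x
    have wm: "w \<in> borel_measurable borel" unfolding w_def by measurable
    have "ennreal (\<bar>\<theta> - (\<theta> + \<Delta>)\<bar> / 16) \<le> minimax_risk f lam \<phi> {-2*A..2*A} n"
    proof (rule minimax_risk_two_point[OF lam \<phi> f wm _ _ n])
      fix x
      show "1 \<le> hellinger_affinity \<phi> (f (x - (\<theta> + \<Delta>)) - f (x - \<theta>)) + w x"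
      proof (cases "x - \<theta> \<in> S")
        case True
        then show ?thesis
          by (simp add: w_def add_increasing)
      next
        case False
        then have "\<bar>f (x - (\<theta> + \<Delta>)) - f (x - \<theta>)\<bar> \<le> H * \<bar>(x - (\<theta> + \<Delta>)) - (x - \<theta>)\<bar> powr \<alpha>"
          using \<Delta>0 by (intro hold) (auto simp: S_def)
        then have "\<bar>f (x - (\<theta> + \<Delta>)) - f (x - \<theta>)\<bar> \<le> H * \<Delta> powr \<alpha>"
          using \<Delta>0 by simp
        then have "\<bar>f (x - (\<theta> + \<Delta>)) - f (x - \<theta>)\<bar>\<^sup>2 \<le> (H * \<Delta> powr \<alpha>)\<^sup>2"
          by (rule power_mono) simp
        also have "\<dots> = H\<^sup>2 * \<Delta> powr (2 * \<alpha>)"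
          by (simp add: power_mult_distrib power2_eq_square flip: powr_add)
        also have "\<dots> \<le> H\<^sup>2 * \<Delta>"
          using powr_mono'[of 1 "2 * \<alpha>" \<Delta>] \<alpha> \<Delta> \<Delta>0 by (intro mult_left_mono) auto
        finally have "K * (f (x - (\<theta> + \<Delta>)) - f (x - \<theta>))\<^sup>2 \<le> K * (H\<^sup>2 * \<Delta>)"
          using K by (intro mult_left_mono) auto
        then have "ennreal (K * (f (x - (\<theta> + \<Delta>)) - f (x - \<theta>))\<^sup>2) \<le> w x"
          using False by (simp add: w_def ennreal_leI mult.assoc)
        then show ?thesis
          by (meson deficit order_trans add_left_mono)
      qed
    next
      have "(\<integral>\<^sup>+ x. ennreal (lam x) * w x \<partial>lborel) = ennreal (K * H\<^sup>2 * \<Delta>)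
          + (\<integral>\<^sup>+ x. ennreal (lam x) * indicator S (x - \<theta>) \<partial>lborel)"
        by (simp add: w_def distrib_left nn_integral_add nn_integral_multc is_densityD(3)[OF lam])
      also have "\<dots> \<le> ennreal (K * H\<^sup>2 * \<Delta>) + ennreal (c * \<Delta>)"
        using light by (rule add_left_mono)
      also have "\<dots> = ennreal (K * H\<^sup>2 * \<Delta> + c * \<Delta>)"
        using K c \<Delta>0 by (simp add: ennreal_plus)
      also have "\<dots> \<le> ennreal (1 / (2 * real n))"
        using rate by (rule ennreal_leI)
      finally show "(\<integral>\<^sup>+ x. ennreal (lam x) * w x \<partial>lborel) \<le> ennreal (1 / (2 * real n))" .
    qed (use A \<theta> \<Delta> \<Delta>0 in auto)
    then have "ennreal (real n) * ennreal (\<Delta> / 16) \<le> ennreal (real n) * minimax_risk f lam \<phi> {-2*A..2*A} n"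
      using \<Delta>0 by (intro mult_left_mono) auto
    moreover have "ennreal (real n) * ennreal (\<Delta> / 16) = ennreal (\<delta> / 16)"
      using n \<delta> by (simp add: \<Delta>_def flip: ennreal_mult')
    ultimately show ?thesis by simp
  qed
  with \<delta> show ?thesis by (intro exI[of _ "\<delta> / 16"]) auto
qed

theorem corollary4p8:
  fixes f lam \<phi> L :: "real \<Rightarrow> real" and \<theta>s A \<alpha> :: real
  assumes "is_density lam" and "is_density \<phi>"
    and "basic_assumptions f lam \<phi> L \<theta>s"
    and "{x. f x \<noteq> 0} \<subseteq> {-A..A}" and "{x. lam x \<noteq> 0} \<subseteq> {-A..A}"
    and "integrable lborel (\<lambda>z. \<bar>z\<bar> * \<phi> z)"
    and "B_smooth_near_0 \<phi>"
  shows "(0 < \<alpha> \<and> \<alpha> \<le> 1 \<and> holder \<alpha> f \<longrightarrow>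
           (\<exists>c::real. c > 0 \<and> (\<forall>n\<ge>1. ennreal c \<le>
              ennreal (real n powr (1 / (2 * \<alpha>))) * minimax_risk f lam \<phi> {-2*A..2*A} n))) \<and>
         (discontinuities f \<noteq> {} \<and> \<alpha> \<ge> 1/2 \<and> piecewise_holder \<alpha> f \<longrightarrow>
           (\<exists>c::real. c > 0 \<and> (\<forall>n\<ge>1. ennreal c \<le>
              ennreal (real n) * minimax_risk f lam \<phi> {-2*A..2*A} n)))"
proof -
  have A: "0 < A"
    using assms(1,5) by (rule density_supported_interval_pos)
  have fin: "finite (discontinuities f)"
    using assms(3) by (simp add: basic_assumptions_def template_assumption_def)
  show ?thesis
    using minimax_risk_holder[OF assms(1,2) finite_discontinuities_measurable[OF fin] assms(7) A, of \<alpha>]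
      minimax_risk_piecewise_holder[OF assms(1,2) fin assms(7) A, of \<alpha>]
    by blast
qed

end
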